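(* Let $r$ and $s$ be fixed integers with $0 \le r < s$ and $\gcd(r,s)=1$. Then all members of the kernel family $\{V_{rN,sN} : N \ge 1\}$ ($N$ ranging over the positive integers) have the same $L^1$-norm; that is, for every integer $N \ge 1$, $$\|V_{rN,sN}\|_{L^1(\mathbb{T})} = \|V_{r,s}\|_{L^1(\mathbb{T})} = \int_0^1 |V_{r,s}(x)|\,dx.$$
   Context: Here $\mathbb{T} = \mathbb{R}/\mathbb{Z}$ and $\|f\|_{L^1(\mathbb{T})} = \int_0^1 |f(x)|\,dx$ for a function $f$ of period $1$. For integers $0 \le r < s$ and $N \ge 1$, the de la Vallée Poussin kernel (of period $1$) is $$V_{rN,sN}(x) = \frac{(\sin sN\pi x)^2 - (\sin rN\pi x)^2}{(s-r)N(\sin \pi x)^2},$$ extended by continuity to integer $x$. Equivalently, $V_{rN,sN} = \frac{s\Delta_{sN} - r\Delta_{rN}}{s-r}$, where $\Delta_m(x) = \frac{1}{m}\left(\frac{\sin \pi m x}{\sin \pi x}\right)^2$ for $m \ge 1$ (Fejér kernel), and the term $r\Delta_{rN}$ is read as $0$ when $r=0$. *)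

theory Defs
  imports "HOL-Analysis.Analysis"
begin

text \<open>
  The de la Vallee Poussin kernel \<open>V\<^bsub>m,n\<^esub>\<close> for \<open>0 \<le> m < n\<close>, with its two indices as arguments, so
  that \<open>V\<^bsub>rN,sN\<^esub>\<close> is \<open>vallee_poussin (r * N) (s * N)\<close> and \<open>n - m\<close> is \<open>(s - r) N\<close>.
  At integers the value is the limit \<open>(n\<^sup>2 - m\<^sup>2) / (n - m) = n + m\<close>; lemma
  \<open>continuous_on_vallee_poussin\<close> shows that this is the extension by continuity.
\<close>

definition vallee_poussin :: "nat \<Rightarrow> nat \<Rightarrow> real \<Rightarrow> real" where
  "vallee_poussin m n x =
     (if x \<in> \<int> then real n + real m
      else ((sin (real n * pi * x))\<^sup>2 - (sin (real m * pi * x))\<^sup>2)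
             / ((real n - real m) * (sin (pi * x))\<^sup>2))"

text \<open>Functions on \<open>\<real>/\<int>\<close> are represented by functions on \<open>\<real>\<close> of period 1.\<close>

definition L1_norm_circle :: "(real \<Rightarrow> real) \<Rightarrow> real" where
  "L1_norm_circle f = (LINT x:{0..1}|lborel. \<bar>f x\<bar>)"

lemma sin_pi_eq_0_iff_Ints: "sin (pi * x) = 0 \<longleftrightarrow> x \<in> \<int>" for x :: real
proof -
  have "sin (pi * x) = 0 \<longleftrightarrow> (\<exists>i::int. pi * x = of_int i * pi)"
    by (rule sin_zero_iff_int2)
  also have "\<dots> \<longleftrightarrow> (\<exists>i::int. x = of_int i)"
    by (auto simp: mult.commute)
  also have "\<dots> \<longleftrightarrow> x \<in> \<int>"
    by (auto elim: Ints_cases)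
  finally show ?thesis .
qed

lemma sin_multiple_quotient:
  "\<exists>D::real \<Rightarrow> real. continuous_on UNIV D \<and> (\<forall>x. D x * sin (pi * x) = sin (real n * pi * x)) \<and>
     (\<forall>x\<in>\<int>. (D x)\<^sup>2 = (real n)\<^sup>2)"
proof -
  have "\<exists>D::real \<Rightarrow> real. continuous_on UNIV D \<and>
          (\<forall>x. D x * sin (pi * x) = sin (real n * pi * x)) \<and>
          (\<forall>x. sin (pi * x) = 0 \<longrightarrow> D x * cos (pi * x) = real n * cos (real n * pi * x))"
  proof (induction n)
    case 0
    show ?case by (rule exI[of _ "\<lambda>_. 0"]) auto
  next
    case (Suc n)
    then obtain D :: "real \<Rightarrow> real" where D: "continuous_on UNIV D"
      "\<And>x. D x * sin (pi * x) = sin (real n * pi * x)"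
      "\<And>x. sin (pi * x) = 0 \<Longrightarrow> D x * cos (pi * x) = real n * cos (real n * pi * x)"
      by blast
    have arg: "real (Suc n) * pi * x = real n * pi * x + pi * x" for x :: real
      by (simp add: algebra_simps)
    let ?E = "\<lambda>x. D x * cos (pi * x) + cos (real n * pi * x)"
    have "continuous_on UNIV ?E"
      by (intro continuous_intros D(1))
    moreover have "?E x * sin (pi * x) = sin (real (Suc n) * pi * x)" for x
      unfolding arg sin_add D(2)[symmetric] by (simp add: algebra_simps)
    moreover have "?E x * cos (pi * x) = real (Suc n) * cos (real (Suc n) * pi * x)"
      if "sin (pi * x) = 0" for x
      unfolding arg cos_add using that by (simp add: D(3) algebra_simps)
    ultimately show ?case by blast
  qed
  then obtain D :: "real \<Rightarrow> real" where D: "continuous_on UNIV D"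
    "\<And>x. D x * sin (pi * x) = sin (real n * pi * x)"
    "\<And>x. sin (pi * x) = 0 \<Longrightarrow> D x * cos (pi * x) = real n * cos (real n * pi * x)"
    by blast
  have "(D x)\<^sup>2 = (real n)\<^sup>2" if "x \<in> \<int>" for x
  proof -
    have s: "sin (pi * x) = 0" using that by (simp add: sin_pi_eq_0_iff_Ints)
    have "sin (real n * pi * x) = 0" using D(2)[of x] s by simp
    then have c: "(cos (pi * x))\<^sup>2 = 1" "(cos (real n * pi * x))\<^sup>2 = 1"
      using s by (simp_all add: cos_squared_eq)
    show ?thesis
      using arg_cong[OF D(3)[OF s], of power2] c by (simp add: power_mult_distrib)
  qed
  with D(1,2) show ?thesis by blast
qed

lemma continuous_on_vallee_poussin:
  assumes "m < n"
  shows "continuous_on UNIV (vallee_poussin m n)"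
proof -
  obtain D E :: "real \<Rightarrow> real" where D: "continuous_on UNIV D"
      "\<And>x. D x * sin (pi * x) = sin (real n * pi * x)" "\<And>x. x \<in> \<int> \<Longrightarrow> (D x)\<^sup>2 = (real n)\<^sup>2"
    and E: "continuous_on UNIV E"
      "\<And>x. E x * sin (pi * x) = sin (real m * pi * x)" "\<And>x. x \<in> \<int> \<Longrightarrow> (E x)\<^sup>2 = (real m)\<^sup>2"
    using sin_multiple_quotient[of n] sin_multiple_quotient[of m] by metis
  have nm: "real n - real m \<noteq> 0" using assms by simp
  have "vallee_poussin m n x = ((D x)\<^sup>2 - (E x)\<^sup>2) / (real n - real m)" for x
  proof (cases "x \<in> \<int>")
    case True
    have "(real n)\<^sup>2 - (real m)\<^sup>2 = (real n + real m) * (real n - real m)"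
      by (simp add: power2_eq_square algebra_simps)
    then show ?thesis using True nm by (simp add: vallee_poussin_def D(3) E(3))
  next
    case False
    then have "(sin (pi * x))\<^sup>2 \<noteq> 0" by (simp add: sin_pi_eq_0_iff_Ints)
    moreover have "(sin (real n * pi * x))\<^sup>2 - (sin (real m * pi * x))\<^sup>2
        = ((D x)\<^sup>2 - (E x)\<^sup>2) * (sin (pi * x))\<^sup>2"
      unfolding D(2)[symmetric] E(2)[symmetric] by (simp add: power_mult_distrib algebra_simps)
    ultimately show ?thesis using False by (simp add: vallee_poussin_def)
  qed
  then have eq: "vallee_poussin m n = (\<lambda>x. ((D x)\<^sup>2 - (E x)\<^sup>2) / (real n - real m))" by blast
  show ?thesis unfolding eq using nm by (intro continuous_intros D(1) E(1)) auto
qed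

end

theory Submission
  imports Defs
begin

text \<open>
  Write \<open>g y = (sin (s \<pi> y))\<^sup>2 - (sin (r \<pi> y))\<^sup>2\<close>, a function of period 1. Off the integers
  \<open>\<bar>V\<^bsub>rN,sN\<^esub> x\<bar> = \<bar>g (N x)\<bar> / ((s - r) N (sin (\<pi> x))\<^sup>2)\<close>: dilation by \<open>N\<close> changes the numerator
  only through its argument, and the denominator is positive, so the absolute value falls on a
  function of \<open>N x\<close> alone. The points \<open>(y + k) / N\<close> with \<open>k < N\<close> are exactly the points of the
  circle that \<open>x \<mapsto> N x\<close> sends to \<open>y\<close>, and \<open>\<bar>g (N x)\<bar>\<close> has the same value \<open>\<bar>g y\<bar>\<close> at all of them.
  Averaging \<open>\<bar>V\<^bsub>rN,sN\<^esub>\<bar>\<close> over these points, which does not change the integral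
  (\<open>integral_unit_interval_fold\<close>), therefore only affects the weight \<open>1 / (sin (\<pi> x))\<^sup>2\<close>, and the
  identity \<open>(\<Sum>k<N. 1 / (sin (\<pi> (y + k) / N))\<^sup>2) = N\<^sup>2 / (sin (\<pi> y))\<^sup>2\<close> (\<open>sum_inverse_sin_squared\<close>)
  says that the averaged function is \<open>\<bar>V\<^bsub>r,s\<^esub>\<bar>\<close> off the integers.

  The identity is Parseval's equation on \<open>\<int>/N\<int>\<close>: by the geometric sum, the ratio
  \<open>(sin (\<pi> y))\<^sup>2 / (sin (\<pi> (y + k) / N))\<^sup>2\<close> is the squared modulus of the \<open>k\<close>-th discrete Fourier
  coefficient of the \<open>N\<close> unimodular numbers \<open>cis (2 \<pi> j y / N)\<close>, \<open>j < N\<close>.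
\<close>

section \<open>A finite Parseval identity for the cosecant\<close>

lemma norm_one_minus_cis_squared: "(cmod (1 - cis t))\<^sup>2 = 4 * (sin (t / 2))\<^sup>2"
proof -
  have "(cmod (1 - cis t))\<^sup>2 = (1 - cos t)\<^sup>2 + (sin t)\<^sup>2"
    by (simp add: cmod_power2)
  also have "\<dots> = 2 - 2 * cos t"
    using sin_cos_squared_add[of t] by (simp add: power2_eq_square algebra_simps)
  also have "cos t = 1 - 2 * (sin (t / 2))\<^sup>2"
    using cos_double_sin[of "t / 2"] by simp
  finally show ?thesis by simp
qed

lemma norm_geometric_sum_cis_squared:
  "(cmod (\<Sum>j<N. cis (2 * pi * x) ^ j))\<^sup>2 * (sin (pi * x))\<^sup>2 = (sin (real N * pi * x))\<^sup>2"
proof -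
  have "(1 - cis (2 * pi * x)) * (\<Sum>j<N. cis (2 * pi * x) ^ j) = 1 - cis (2 * (real N * pi * x))"
    by (subst one_diff_power_eq[symmetric]) (simp add: Complex.DeMoivre algebra_simps)
  then have "(cmod (1 - cis (2 * pi * x)))\<^sup>2 * (cmod (\<Sum>j<N. cis (2 * pi * x) ^ j))\<^sup>2
      = (cmod (1 - cis (2 * (real N * pi * x))))\<^sup>2"
    by (metis norm_mult power_mult_distrib)
  then show ?thesis
    unfolding norm_one_minus_cis_squared by (simp add: mult.commute)
qed

lemma sum_cis_characters:
  assumes "j < N" "l < N"
  shows "(\<Sum>k<N. cis (2 * pi * (real j - real l) * real k / real N))
    = (if j = l then of_nat N else 0)"
proof (cases "j = l")
  case False
  define w where "w = cis (2 * pi * (real j - real l) / real N)"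
  have N: "real N > 0" using assms by simp
  have "w ^ N = cis (2 * pi * of_int (int j - int l))"
    using N by (simp add: w_def Complex.DeMoivre)
  then have wN: "w ^ N = 1"
    by (simp only: cis_multiple_2pi Ints_of_int)
  have "w \<noteq> 1"
  proof
    assume "w = 1"
    then have "cos (2 * pi * (real j - real l) / real N) = 1"
      by (simp add: w_def complex_eq_iff)
    then obtain i :: int where "2 * pi * (real j - real l) / real N = of_int i * 2 * pi"
      using cos_one_2pi_int by blast
    then have "2 * pi * (real j - real l) = 2 * pi * (of_int i * real N)"
      using N by (simp add: field_simps)
    then have "real j - real l = of_int i * real N"
      by (subst (asm) mult_cancel_left) simp
    then have i: "int j - int l = i * int N"
      by (metis of_int_diff of_int_eq_iff of_int_mult of_int_of_nat_eq)
    moreover have "\<bar>int j - int l\<bar> < int N" using assms by linarith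
    ultimately have "int j - int l = 0"
      by (metis dvd_imp_le_int dvd_triv_right linorder_not_le abs_of_nat)
    with False show False by simp
  qed
  then have "(\<Sum>k<N. w ^ k) = 0"
    using wN by (simp add: geometric_sum)
  moreover have "w ^ k = cis (2 * pi * (real j - real l) * real k / real N)" for k
    by (simp add: w_def Complex.DeMoivre mult_ac)
  ultimately show ?thesis using False by simp
qed simp

text \<open>
  Expanding the squared modulus gives a double sum over \<open>j, l\<close>; summing over \<open>k\<close> first leaves only
  the diagonal, by orthogonality of the characters of \<open>\<int>/N\<int>\<close>.
\<close>

lemma sum_norm_geometric_sum_cis_squared:
  "(\<Sum>k<N. (cmod (\<Sum>j<N. cis (2 * pi * ((y + real k) / real N)) ^ j))\<^sup>2) = (real N)\<^sup>2"
proof -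
  let ?c = "\<lambda>k j. cis (2 * pi * ((y + real k) / real N)) ^ j"
  have prod: "?c k j * cnj (?c k l) = cis (2 * pi * (real j - real l) * y / real N)
      * cis (2 * pi * (real j - real l) * real k / real N)" for k j l
    by (simp add: Complex.DeMoivre cis_cnj cis_mult)
       (rule arg_cong[where f = cis], simp add: add_divide_distrib diff_divide_distrib algebra_simps)
  have "complex_of_real (\<Sum>k<N. (cmod (\<Sum>j<N. ?c k j))\<^sup>2)
      = (\<Sum>k<N. \<Sum>j<N. \<Sum>l<N. ?c k j * cnj (?c k l))"
    by (simp only: of_real_sum complex_norm_square cnj_sum sum_product)
  also have "\<dots> = (\<Sum>j<N. \<Sum>k<N. \<Sum>l<N. ?c k j * cnj (?c k l))"
    by (rule sum.swap)
  also have "\<dots> = (\<Sum>j<N. \<Sum>l<N. \<Sum>k<N. ?c k j * cnj (?c k l))"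
    by (intro sum.cong refl sum.swap)
  also have "\<dots> = (\<Sum>j<N. \<Sum>l<N. cis (2 * pi * (real j - real l) * y / real N)
      * (if j = l then of_nat N else 0))"
    unfolding prod sum_distrib_left[symmetric] by (intro sum.cong refl) (simp add: sum_cis_characters)
  also have "\<dots> = (\<Sum>j<N. \<Sum>l<N. if j = l then of_nat N else 0)"
    by (intro sum.cong refl) simp
  also have "\<dots> = complex_of_real ((real N)\<^sup>2)"
    by (simp add: power2_eq_square)
  finally show ?thesis
    by (simp only: of_real_eq_iff)
qed

lemma shift_divide_notin_Ints:
  fixes y :: real
  assumes "y \<notin> \<int>" "N \<ge> 1"
  shows "(y + real k) / real N \<notin> \<int>"
proof
  assume "(y + real k) / real N \<in> \<int>"
  then have "real N * ((y + real k) / real N) - real k \<in> \<int>" by (intro Ints_diff Ints_mult) auto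
  with assms show False by simp
qed

lemma sin_pi_squared_shift: "(sin (real m * pi * (y + real k)))\<^sup>2 = (sin (real m * pi * y))\<^sup>2"
proof -
  have "real m * pi * (y + real k) = real m * pi * y + real (m * k) * pi"
    by (simp add: algebra_simps)
  then show ?thesis
    by (simp only: sin_add sin_npi cos_npi) (simp add: power_mult_distrib flip: power_mult)
qed

lemma sum_inverse_sin_squared:
  fixes y :: real
  assumes "y \<notin> \<int>" "N \<ge> 1"
  shows "(\<Sum>k<N. 1 / (sin (pi * ((y + real k) / real N)))\<^sup>2) = (real N)\<^sup>2 / (sin (pi * y))\<^sup>2"
proof -
  have "1 / (sin (pi * ((y + real k) / real N)))\<^sup>2
      = (cmod (\<Sum>j<N. cis (2 * pi * ((y + real k) / real N)) ^ j))\<^sup>2 / (sin (pi * y))\<^sup>2" for k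
  proof -
    have nz: "sin (pi * ((y + real k) / real N)) \<noteq> 0" "sin (pi * y) \<noteq> 0"
      using shift_divide_notin_Ints[OF assms] assms(1) by (simp_all only: sin_pi_eq_0_iff_Ints not_False_eq_True)
    have "real N * pi * ((y + real k) / real N) = real 1 * pi * (y + real k)"
      using assms(2) by simp
    then have "(sin (real N * pi * ((y + real k) / real N)))\<^sup>2 = (sin (pi * y))\<^sup>2"
      using sin_pi_squared_shift[of 1 y k] by (simp only:) simp
    then have "(cmod (\<Sum>j<N. cis (2 * pi * ((y + real k) / real N)) ^ j))\<^sup>2
        * (sin (pi * ((y + real k) / real N)))\<^sup>2 = (sin (pi * y))\<^sup>2"
      by (simp only: norm_geometric_sum_cis_squared)
    with nz show ?thesis
      by (simp only: frac_eq_eq power_not_zero mult_1_left mult.commute not_False_eq_True)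
  qed
  then show ?thesis
    by (simp only: sum_divide_distrib[symmetric] sum_norm_geometric_sum_cis_squared)
qed

section \<open>Folding the circle\<close>

text \<open>The unit interval is cut at the multiples of \<open>1 / N\<close> and each piece is stretched to length 1.\<close>

lemma integral_unit_interval_fold:
  fixes F :: "real \<Rightarrow> real"
  assumes F: "continuous_on UNIV F" and N: "N \<ge> 1"
  shows "integral {0..1} F = integral {0..1} (\<lambda>y. (\<Sum>k<N. F ((y + real k) / real N)) / real N)"
proof -
  have N0: "real N > 0" using N by simp
  have cont: "continuous_on A (\<lambda>y. F ((y + real k) / real N))" for A k
    using N0 by (intro continuous_on_compose2[OF F] continuous_intros) auto
  have int: "F integrable_on {a..b}" for a b
    by (intro integrable_continuous_real continuous_on_subset[OF F]) simp
  have piece: "integral {real k / real N..real (Suc k) / real N} F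
      = integral {0..1} (\<lambda>y. F ((y + real k) / real N)) / real N" for k
  proof -
    have "((\<lambda>y. F ((1 / real N) *\<^sub>R y + real k / real N)) has_integral
        (1 / \<bar>1 / real N\<bar> ^ DIM(real)) *\<^sub>R integral {real k / real N..real (Suc k) / real N} F)
        ((\<lambda>x. (1 / (1 / real N)) *\<^sub>R x + - ((1 / (1 / real N)) *\<^sub>R (real k / real N)))
          ` cbox (real k / real N) (real (Suc k) / real N))"
      using N0 int by (intro has_integral_affinity) (auto simp: integrable_integral)
    moreover have "((\<lambda>x. (1 / (1 / real N)) *\<^sub>R x + - ((1 / (1 / real N)) *\<^sub>R (real k / real N)))
          ` cbox (real k / real N) (real (Suc k) / real N)) = {0..1}"
      using N0 image_affinity_atLeastAtMost[of "real N" "- real k" "real k / real N" "real (Suc k) / real N"]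
      by (simp add: divide_right_mono)
    ultimately have "((\<lambda>y. F ((y + real k) / real N)) has_integral
        real N * integral {real k / real N..real (Suc k) / real N} F) {0..1}"
      using N0 by (simp add: add_divide_distrib)
    then show ?thesis using N0 by (simp add: integral_unique)
  qed
  have "integral {0..real n / real N} F
      = (\<Sum>k<n. integral {real k / real N..real (Suc k) / real N} F)" for n
  proof (induction n)
    case (Suc n)
    have "integral {0..real n / real N} F + integral {real n / real N..real (Suc n) / real N} F
        = integral {0..real (Suc n) / real N} F"
      using N0 by (intro Henstock_Kurzweil_Integration.integral_combine int) (auto simp: divide_right_mono)
    with Suc show ?case by simp
  qed simp
  from this[of N] have "integral {0..1} F
      = (\<Sum>k<N. integral {real k / real N..real (Suc k) / real N} F)"
    using N0 by simp
  also have "\<dots> = integral {0..1} (\<lambda>y. (\<Sum>k<N. F ((y + real k) / real N)) / real N)"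
    unfolding piece
    by (simp add: sum_divide_distrib[symmetric] integral_sum integrable_continuous_real cont)
  finally show ?thesis .
qed

section \<open>The norm of the dilated kernels\<close>

lemma L1_norm_circle_eq_integral:
  assumes "continuous_on UNIV f"
  shows "L1_norm_circle f = integral {0..1} (\<lambda>x. \<bar>f x\<bar>)"
  unfolding L1_norm_circle_def
  by (intro set_borel_integral_eq_integral borel_integrable_atLeastAtMost' continuous_intros
        continuous_on_subset[OF assms]) simp

lemma abs_vallee_poussin:
  assumes "m < n" "x \<notin> \<int>"
  shows "\<bar>vallee_poussin m n x\<bar> = \<bar>(sin (real n * pi * x))\<^sup>2 - (sin (real m * pi * x))\<^sup>2\<bar>
    / (real n - real m) * (1 / (sin (pi * x))\<^sup>2)"
  using assms by (simp add: vallee_poussin_def abs_mult)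

lemma average_abs_vallee_poussin:
  fixes y :: real
  assumes "r < s" "N \<ge> 1" "y \<notin> \<int>"
  shows "(\<Sum>k<N. \<bar>vallee_poussin (r * N) (s * N) ((y + real k) / real N)\<bar>) / real N
    = \<bar>vallee_poussin r s y\<bar>"
proof -
  define g where "g = \<bar>(sin (real s * pi * y))\<^sup>2 - (sin (real r * pi * y))\<^sup>2\<bar>"
  have arg: "(sin (real (m * N) * pi * ((y + real k) / real N)))\<^sup>2 = (sin (real m * pi * y))\<^sup>2" for m k
  proof -
    have "real (m * N) * pi * ((y + real k) / real N) = real m * pi * (y + real k)"
      using assms(2) by simp
    then show ?thesis by (simp only: sin_pi_squared_shift)
  qed
  have "\<bar>vallee_poussin (r * N) (s * N) ((y + real k) / real N)\<bar>
      = g / (real (s * N) - real (r * N)) * (1 / (sin (pi * ((y + real k) / real N)))\<^sup>2)" for k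
    using assms shift_divide_notin_Ints[of y N k]
    by (subst abs_vallee_poussin) (simp_all only: arg g_def, simp_all)
  then have "(\<Sum>k<N. \<bar>vallee_poussin (r * N) (s * N) ((y + real k) / real N)\<bar>) / real N
      = g / (real (s * N) - real (r * N)) * ((real N)\<^sup>2 / (sin (pi * y))\<^sup>2) / real N"
    by (simp only: sum_distrib_left[symmetric] sum_inverse_sin_squared[OF assms(3,2)])
  also have "real (s * N) - real (r * N) = (real s - real r) * real N"
    by (simp add: algebra_simps)
  also have "g / ((real s - real r) * real N) * ((real N)\<^sup>2 / (sin (pi * y))\<^sup>2) / real N
      = g / (real s - real r) * (1 / (sin (pi * y))\<^sup>2)"
    using assms(2) by (simp add: power2_eq_square)
  also have "\<dots> = \<bar>vallee_poussin r s y\<bar>"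
    unfolding g_def by (rule abs_vallee_poussin[OF assms(1,3), symmetric])
  finally show ?thesis .
qed

theorem theorem1p1:
  fixes r s :: nat
  assumes "r < s" and "gcd r s = 1"
  shows "\<forall>N::nat. N \<ge> 1 \<longrightarrow>
    L1_norm_circle (vallee_poussin (r * N) (s * N)) = L1_norm_circle (vallee_poussin r s)"
proof (intro allI impI)
  fix N :: nat
  assume N: "N \<ge> 1"
  have cont: "continuous_on UNIV (vallee_poussin (r * N) (s * N))" "continuous_on UNIV (vallee_poussin r s)"
    using assms(1) N by (simp_all add: continuous_on_vallee_poussin)
  have "L1_norm_circle (vallee_poussin (r * N) (s * N)) = integral {0..1}
      (\<lambda>y. (\<Sum>k<N. \<bar>vallee_poussin (r * N) (s * N) ((y + real k) / real N)\<bar>) / real N)"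
    unfolding L1_norm_circle_eq_integral[OF cont(1)]
    by (intro integral_unit_interval_fold continuous_intros cont(1) N)
  also have "\<dots> = integral {0..1} (\<lambda>y. \<bar>vallee_poussin r s y\<bar>)"
  proof (rule integral_spike[of "{0, 1}"])
    fix y :: real
    assume "y \<in> {0..1} - {0, 1}"
    then have "y \<notin> \<int>"
      by (auto elim!: Ints_cases)
    then show "\<bar>vallee_poussin r s y\<bar>
        = (\<Sum>k<N. \<bar>vallee_poussin (r * N) (s * N) ((y + real k) / real N)\<bar>) / real N"
      using average_abs_vallee_poussin[OF assms(1) N] by simp
  qed simp
  also have "\<dots> = L1_norm_circle (vallee_poussin r s)"
    by (rule L1_norm_circle_eq_integral[OF cont(2), symmetric])
  finally show "L1_norm_circle (vallee_poussin (r * N) (s * N)) = L1_norm_circle (vallee_poussin r s)" .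
qed

end
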